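(* Let $T=\{\mathbf y_1,\dots,\mathbf y_M\}$ be the periodic square lattice of edge length $h$ in the unit square $\Omega$ and let $S=S_1\cup S_2=\{\mathbf z_1,\dots,\mathbf z_{2M}\}$ be the set of points $\mathbf z_{J,i}^{\pm}=\mathbf y_J\pm \tfrac h2 \mathbf e_i$ ($i=1,2$, $J=1,\dots,M$), so that $S$ and $T$ form a virtual staggered structure. Suppose that the node set $R=\{\mathbf x_1,\dots,\mathbf x_N\}$ realizes both $S$ and $T$. Then there is a constant $\mu>0$, independent of $h$, such that the inf-sup condition $$\inf_{P}\ \sup_{U}\ \frac{\langle D^*U,P\rangle}{\|P\|_{l^2}\,\|DU\|_{l^2}}\ \ge\ \mu $$ holds, where the infimum is over all nonzero discrete pressures $P=(P_I)_{I=1}^M\in\mathbb R^M$ on $T$, and the supremum is over all discrete velocities $U=(u,v)$, $u:S_1\to\mathbb R$, $v:S_2\to\mathbb R$, with $DU\neq 0$. Here, by realization, every such $P$ is of the form $P_I=\sum_{J=1}^N\Psi_J(\mathbf y_I)p_J$ and every such $U$ is of the form $u(\mathbf z)=\sum_{J=1}^N\Psi_J(\mathbf z)u_J$ for $\mathbf z\in S_1$, $v(\mathbf z)=\sum_{J=1}^N\Psi_J(\mathbf z)v_J$ for $\mathbf z\in S_2$, with $(p_J),(u_J),(v_J)\in\mathbb R^N$.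
   Context: Everything is $1$-periodic in each variable; $\Omega=(0,1)^2$ is identified with the torus, and $h=1/n$ for a positive integer $n$. $\mathbf e_1=(1,0)$, $\mathbf e_2=(0,1)$. Lattices: $T=\{(kh,jh)\}$ ($k,j$ integers, modulo periodicity), so $M=n^2$. $S_1=T+(h/2,0)$ carries the first velocity component, $S_2=T+(0,h/2)$ the second; $S=S_1\cup S_2$ has $2M$ points. Shape functions: $R=\{\mathbf x_1,\dots,\mathbf x_N\}\subset\Omega$ is a finite regular node set (a set of nodes for which the shape functions below are defined), $\rho>0$ a dilation parameter, $\Phi\ge 0$ a smooth compactly supported window function on $\mathbb R^2$, $P_m(\mathbf x)$ the row vector of all monomials $x_1^{\alpha_1}x_2^{\alpha_2}$ with $\alpha_1+\alpha_2\le m$. With differences of points taken modulo periods, $$M(\mathbf x)=\sum_{I}P_m^t\Big(\frac{\mathbf x-\mathbf x_I}{\rho}\Big)P_m\Big(\frac{\mathbf x-\mathbf x_I}{\rho}\Big)\frac1{\rho^2}\Phi\Big(\frac{\mathbf x-\mathbf x_I}{\rho}\Big),$$ $$\Psi_I(\mathbf x)=P_m(0)[M(\mathbf x)]^{-1}P_m^t\Big(\frac{\mathbf x-\mathbf x_I}{\rho}\Big)\frac1{\rho^2}\Phi\Big(\frac{\mathbf x-\mathbf x_I}{\rho}\Big).$$ Realization: $R$ realizes a finite point set $\{\mathbf w_1,\dots,\mathbf w_L\}$ if for each $(W_1,\dots,W_L)\in\mathbb R^{L}$ there is $(w_1,\dots,w_N)\in\mathbb R^N$ such that $W_J=\sum_{I=1}^N\Psi_I(\mathbf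 w_J)w_I$ for $J=1,\dots,L$. Discrete operators: for $U=(u,v)$, $u:S_1\to\mathbb R$, $v:S_2\to\mathbb R$, the discrete divergence is $$(D^*U)_I=\frac{u(\mathbf y_I+\frac h2\mathbf e_1)-u(\mathbf y_I-\frac h2\mathbf e_1)}{h}+\frac{v(\mathbf y_I+\frac h2\mathbf e_2)-v(\mathbf y_I-\frac h2\mathbf e_2)}{h},\qquad I=1,\dots,M.$$ $DU$ is the collection of all first difference quotients $\frac{u(\mathbf z+h\mathbf e_i)-u(\mathbf z)}{h}$ ($\mathbf z\in S_1$, $i=1,2$) and $\frac{v(\mathbf z+h\mathbf e_i)-v(\mathbf z)}{h}$ ($\mathbf z\in S_2$, $i=1,2$). $\langle\cdot,\cdot\rangle$ is the Euclidean inner product on $\mathbb R^M$ and $\|\cdot\|_{l^2}$ is the unweighted Euclidean norm.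
   Formalization: The infimum is taken over nonzero discrete pressures P whose values on T sum to zero, since for a nonzero constant P periodicity gives ⟨D*U,P⟩ = 0 for every U, so the condition over all nonzero P is false. *)

theory Defs
  imports
    "HOL-Library.Extended_Real"
    "HOL-Analysis.Elementary_Topology"
    "HOL-Analysis.Product_Vector"
    "HOL-Analysis.L2_Norm"
    "Jordan_Normal_Form.Gauss_Jordan_Elimination"
begin

type_synonym point = "real \<times> real"

definition e1 :: point where "e1 = (1, 0)"
definition e2 :: point where "e2 = (0, 1)"

subsection \<open>The torus\<close>

text \<open>Points of the torus are represented in the fundamental domain \<open>[0,1)\<^sup>2\<close>;
  \<open>tor\<close> reduces a point of the plane to its representative.\<close>

definition torus :: "point set" where
  "torus = {0..<1} \<times> {0..<1}"

definition tor :: "point \<Rightarrow> point" where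
  "tor x = (frac (fst x), frac (snd x))"

text \<open>The difference \<open>x - y\<close> modulo periods, represented in \<open>[-1/2,1/2)\<^sup>2\<close>, so that
  it is the shortest displacement from \<open>y\<close> to \<open>x\<close> on the torus.\<close>

definition pdiff :: "point \<Rightarrow> point \<Rightarrow> point" where
  "pdiff x y = (frac (fst x - fst y + 1/2) - 1/2, frac (snd x - snd y + 1/2) - 1/2)"

subsection \<open>Window and shape functions\<close>

primrec C_k :: "nat \<Rightarrow> (point \<Rightarrow> real) \<Rightarrow> bool" where
  "C_k 0 f \<longleftrightarrow> continuous_on UNIV f"
| "C_k (Suc k) f \<longleftrightarrow>
     (\<exists>g1 g2. (\<forall>x. (f has_derivative (\<lambda>v. fst v * g1 x + snd v * g2 x)) (at x)) \<and>
              C_k k g1 \<and> C_k k g2)"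

definition window_function :: "(point \<Rightarrow> real) \<Rightarrow> bool" where
  "window_function \<Phi> \<longleftrightarrow>
     (\<forall>x. \<Phi> x \<ge> 0) \<and> (\<forall>k. C_k k \<Phi>) \<and> compact (closure {x. \<Phi> x \<noteq> 0})"

definition exponents :: "nat \<Rightarrow> (nat \<times> nat) list" where
  "exponents m = filter (\<lambda>(a, b). a + b \<le> m) (List.product [0..<Suc m] [0..<Suc m])"

definition monomials :: "nat \<Rightarrow> point \<Rightarrow> real vec" where
  "monomials m x =
     vec (length (exponents m)) (\<lambda>i. case exponents m ! i of (a, b) \<Rightarrow> fst x ^ a * snd x ^ b)"

definition scaled_window :: "(point \<Rightarrow> real) \<Rightarrow> real \<Rightarrow> point \<Rightarrow> real" where
  "scaled_window \<Phi> \<rho> d = 1 / \<rho>\<^sup>2 * \<Phi> (d /\<^sub>R \<rho>)"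

text \<open>The entry \<open>(i, j)\<close> is that of the sum over the nodes \<open>y\<close> of the outer products
  \<open>P\<^sub>m\<^sup>t P\<^sub>m\<close> of the row vector \<open>P\<^sub>m\<close> at \<open>(x - y)/\<rho>\<close>, weighted by the window.\<close>

definition moment_matrix ::
  "nat \<Rightarrow> (point \<Rightarrow> real) \<Rightarrow> real \<Rightarrow> point set \<Rightarrow> point \<Rightarrow> real mat" where
  "moment_matrix m \<Phi> \<rho> R x =
     mat (length (exponents m)) (length (exponents m))
       (\<lambda>(i, j). \<Sum>y\<in>R. vec_index (monomials m (pdiff x y /\<^sub>R \<rho>)) i *
                         vec_index (monomials m (pdiff x y /\<^sub>R \<rho>)) j *
                         scaled_window \<Phi> \<rho> (pdiff x y))"

text \<open>Nodes index themselves: \<open>shape m \<Phi> \<rho> R y\<close> is the shape function of the node \<open>y \<in> R\<close>.\<close>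

definition shape ::
  "nat \<Rightarrow> (point \<Rightarrow> real) \<Rightarrow> real \<Rightarrow> point set \<Rightarrow> point \<Rightarrow> point \<Rightarrow> real" where
  "shape m \<Phi> \<rho> R y x =
     scalar_prod (monomials m 0)
       (mult_mat_vec (the (mat_inverse (moment_matrix m \<Phi> \<rho> R x)))
         (monomials m (pdiff x y /\<^sub>R \<rho>))) * scaled_window \<Phi> \<rho> (pdiff x y)"

definition regular_nodes :: "nat \<Rightarrow> (point \<Rightarrow> real) \<Rightarrow> real \<Rightarrow> point set \<Rightarrow> bool" where
  "regular_nodes m \<Phi> \<rho> R \<longleftrightarrow>
     finite R \<and> R \<subseteq> torus \<and> (\<forall>x\<in>torus. invertible_mat (moment_matrix m \<Phi> \<rho> R x))"

definition realizes ::
  "nat \<Rightarrow> (point \<Rightarrow> real) \<Rightarrow> real \<Rightarrow> point set \<Rightarrow> point set \<Rightarrow> bool" where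
  "realizes m \<Phi> \<rho> R A \<longleftrightarrow>
     (\<forall>W :: point \<Rightarrow> real. \<exists>w :: point \<Rightarrow> real.
        \<forall>z\<in>A. W z = (\<Sum>y\<in>R. shape m \<Phi> \<rho> R y z * w y))"

subsection \<open>The staggered lattices, with edge length \<open>h = 1/n\<close>\<close>

definition T :: "nat \<Rightarrow> point set" where
  "T n = {tor (of_int k * (1 / real n), of_int j * (1 / real n)) | k j :: int. True}"

definition S1 :: "nat \<Rightarrow> point set" where
  "S1 n = (\<lambda>y. tor (y + (1 / real n / 2) *\<^sub>R e1)) ` T n"

definition S2 :: "nat \<Rightarrow> point set" where
  "S2 n = (\<lambda>y. tor (y + (1 / real n / 2) *\<^sub>R e2)) ` T n"

definition S :: "nat \<Rightarrow> point set" where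
  "S n = S1 n \<union> S2 n"

subsection \<open>Discrete operators\<close>

text \<open>A discrete velocity is a pair \<open>(u, v)\<close>; only the values of \<open>u\<close> on \<open>S1 n\<close>
  and of \<open>v\<close> on \<open>S2 n\<close> enter the definitions below.\<close>

type_synonym velocity = "(point \<Rightarrow> real) \<times> (point \<Rightarrow> real)"

definition div_star :: "nat \<Rightarrow> velocity \<Rightarrow> point \<Rightarrow> real" where
  "div_star n U y = (let h = 1 / real n; (u, v) = U in
     (u (tor (y + (h / 2) *\<^sub>R e1)) - u (tor (y - (h / 2) *\<^sub>R e1))) / h +
     (v (tor (y + (h / 2) *\<^sub>R e2)) - v (tor (y - (h / 2) *\<^sub>R e2))) / h)"

definition dquot :: "nat \<Rightarrow> (point \<Rightarrow> real) \<Rightarrow> point \<times> point \<Rightarrow> real" where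
  "dquot n f = (\<lambda>(e, z). let h = 1 / real n in (f (tor (z + h *\<^sub>R e)) - f z) / h)"

text \<open>\<open>DU\<close> is the family of all first difference quotients: the left summand of its
  index set carries those of \<open>u\<close>, the right summand those of \<open>v\<close>.\<close>

definition D_index :: "nat \<Rightarrow> ((point \<times> point) + (point \<times> point)) set" where
  "D_index n = ({e1, e2} \<times> S1 n) <+> ({e1, e2} \<times> S2 n)"

definition D :: "nat \<Rightarrow> velocity \<Rightarrow> (point \<times> point) + (point \<times> point) \<Rightarrow> real" where
  "D n U = case_sum (dquot n (fst U)) (dquot n (snd U))"

definition D_norm :: "nat \<Rightarrow> velocity \<Rightarrow> real" where
  "D_norm n U = L2_set (D n U) (D_index n)"

definition pressure_inner :: "nat \<Rightarrow> (point \<Rightarrow> real) \<Rightarrow> (point \<Rightarrow> real) \<Rightarrow> real" where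
  "pressure_inner n P Q = (\<Sum>y\<in>T n. P y * Q y)"

subsection \<open>Basic facts\<close>

lemma frac_add_frac: "frac (frac a + b) = frac (a + b)" for a b :: real
proof -
  have "frac a + b = (a + b) - of_int \<lfloor>a\<rfloor>" by (simp add: frac_def)
  then show ?thesis unfolding frac_def by (simp only: floor_diff_of_int)
qed

lemma tor_tor_add: "tor (tor x + y) = tor (x + y)"
  by (simp add: tor_def frac_add_frac)

lemma tor_tor_diff: "tor (tor x - y) = tor (x - y)"
  using tor_tor_add[of x "- y"] by simp

lemma tor_T: "y \<in> T n \<Longrightarrow> tor y = y"
  by (auto simp: T_def tor_def)

lemma tor_shift_T:
  assumes "y \<in> T n" "e \<in> {e1, e2}"
  shows "tor (y + (1 / real n) *\<^sub>R e) \<in> T n" "tor (y - (1 / real n) *\<^sub>R e) \<in> T n"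
proof -
  obtain k j where y: "y = tor (of_int k * (1 / real n), of_int j * (1 / real n))"
    using assms(1) unfolding T_def by blast
  have *: "tor (of_int k' * (1 / real n), of_int j' * (1 / real n)) \<in> T n" for k' j'
    unfolding T_def by blast
  show "tor (y + (1 / real n) *\<^sub>R e) \<in> T n"
    using assms(2) *[of "k + 1" j] *[of k "j + 1"]
    by (auto simp: y tor_tor_add e1_def e2_def add_divide_distrib)
  show "tor (y - (1 / real n) *\<^sub>R e) \<in> T n"
    using assms(2) *[of "k - 1" j] *[of k "j - 1"]
    by (auto simp: y tor_tor_diff e1_def e2_def diff_divide_distrib)
qed

lemma S_eq:
  "S n = (\<Union>y\<in>T n. \<Union>e\<in>{e1, e2}.
     {tor (y + (1 / real n / 2) *\<^sub>R e), tor (y - (1 / real n / 2) *\<^sub>R e)})"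
proof -
  have "tor (y - (1 / real n / 2) *\<^sub>R e) \<in> (\<lambda>y. tor (y + (1 / real n / 2) *\<^sub>R e)) ` T n"
    if "y \<in> T n" "e \<in> {e1, e2}" for y e
  proof (rule image_eqI)
    show "tor (y - (1 / real n) *\<^sub>R e) \<in> T n"
      using tor_shift_T that by blast
    have "y - (1 / real n) *\<^sub>R e + (1 / real n / 2) *\<^sub>R e = y - (1 / real n / 2) *\<^sub>R e"
      by (simp add: prod_eq_iff field_simps)
    then show "tor (y - (1 / real n / 2) *\<^sub>R e) =
      tor (tor (y - (1 / real n) *\<^sub>R e) + (1 / real n / 2) *\<^sub>R e)"
      by (simp only: tor_tor_add)
  qed
  then show ?thesis
    unfolding S_def S1_def S2_def by blast
qed

lemma sum_half_shift:
  assumes "e \<in> {e1, e2}"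
  shows "(\<Sum>y\<in>T n. f (tor (y + (1 / real n / 2) *\<^sub>R e))) =
         (\<Sum>y\<in>T n. f (tor (y - (1 / real n / 2) *\<^sub>R e)))"
proof (rule sum.reindex_bij_witness[of _ "\<lambda>y. tor (y - (1 / real n) *\<^sub>R e)"
      "\<lambda>y. tor (y + (1 / real n) *\<^sub>R e)"])
  fix y assume y: "y \<in> T n"
  show "tor (tor (y + (1 / real n) *\<^sub>R e) - (1 / real n) *\<^sub>R e) = y"
    "tor (tor (y - (1 / real n) *\<^sub>R e) + (1 / real n) *\<^sub>R e) = y"
    by (simp_all add: tor_tor_add tor_tor_diff tor_T[OF y])
  show "tor (y + (1 / real n) *\<^sub>R e) \<in> T n" "tor (y - (1 / real n) *\<^sub>R e) \<in> T n"
    using tor_shift_T[OF y assms] by auto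
  have "y + (1 / real n) *\<^sub>R e - (1 / real n / 2) *\<^sub>R e = y + (1 / real n / 2) *\<^sub>R e"
    by (simp add: prod_eq_iff field_simps)
  then show "f (tor (tor (y + (1 / real n) *\<^sub>R e) - (1 / real n / 2) *\<^sub>R e)) =
    f (tor (y + (1 / real n / 2) *\<^sub>R e))"
    by (simp only: tor_tor_diff)
qed

text \<open>On the torus every discrete divergence has zero sum, so nonzero constant pressures are
  orthogonal to all of them and admit no positive inf-sup constant. This is why the inf-sup
  condition has to be stated for pressures normalized by \<open>(\<Sum>y\<in>T n. P y) = 0\<close>.\<close>

lemma sum_div_star: "(\<Sum>y\<in>T n. div_star n U y) = 0"
proof -
  have "(\<Sum>y\<in>T n. div_star n U y) =
    ((\<Sum>y\<in>T n. fst U (tor (y + (1 / real n / 2) *\<^sub>R e1))) -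
     (\<Sum>y\<in>T n. fst U (tor (y - (1 / real n / 2) *\<^sub>R e1)))) / (1 / real n) +
    ((\<Sum>y\<in>T n. snd U (tor (y + (1 / real n / 2) *\<^sub>R e2))) -
     (\<Sum>y\<in>T n. snd U (tor (y - (1 / real n / 2) *\<^sub>R e2)))) / (1 / real n)"
    by (simp only: div_star_def Let_def case_prod_unfold sum.distrib
        flip: sum_subtractf sum_divide_distrib)
  then show ?thesis
    by (simp only: sum_half_shift[of e1] sum_half_shift[of e2] insert_iff simp_thms
        diff_self div_0 add_0)
qed

lemma pressure_inner_div_star_const: "pressure_inner n (div_star n U) (\<lambda>_. c) = 0"
  by (simp add: pressure_inner_def sum_div_star flip: sum_distrib_right)

end

theory Submission
  imports Defs "Jordan_Normal_Form.Determinant"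
begin

text \<open>The constant \<open>\<mu> = 1\<close> works. Given a mean-zero pressure \<open>P\<close>, solve the discrete Poisson equation
  \<open>\<Delta>\<phi> = P\<close> on the periodic lattice and let \<open>U\<close> be the discrete gradient of \<open>\<phi>\<close>, which lives
  on the staggered points. Then \<open>D\<^sup>*U = P\<close>, and \<open>DU\<close> consists of the second differences of \<open>\<phi>\<close>.
  As shifts are commuting bijections of the torus, summation by parts gives
  \<open>\<parallel>D\<^sup>2\<phi>\<parallel> = \<parallel>\<Delta>\<phi>\<parallel>\<close>, so that \<open>U\<close> attains the quotient \<open>1\<close>.\<close>

section \<open>Linear systems over a finite index set\<close>

text \<open>A square system with trivial null space is solvable. Enumerating \<open>A\<close> turns
  \<open>K\<close> into a matrix; a zero determinant would give a nonzero null vector, which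
  transported back to \<open>A\<close> contradicts injectivity.\<close>

lemma kernel_injective_imp_surjective:
  fixes K :: "'a \<Rightarrow> 'a \<Rightarrow> real" and g :: "'a \<Rightarrow> real"
  assumes "finite A"
    and inj: "\<And>f. (\<And>x. x \<in> A \<Longrightarrow> (\<Sum>y\<in>A. K x y * f y) = 0) \<Longrightarrow> (\<And>x. x \<in> A \<Longrightarrow> f x = 0)"
  obtains f where "\<And>x. x \<in> A \<Longrightarrow> (\<Sum>y\<in>A. K x y * f y) = g x"
proof -
  define N where "N = card A"
  obtain e where e: "bij_betw e {0..<N} A"
    using ex_bij_betw_nat_finite[OF assms(1)] unfolding N_def by blast
  define e' where "e' = inv_into {0..<N} e"
  have e'e: "e' (e i) = i" if "i < N" for i
    using that e unfolding e'_def bij_betw_def by simp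
  have e': "e' x < N" "e (e' x) = x" if "x \<in> A" for x
    using that e unfolding e'_def bij_betw_def
    by (metis atLeastLessThan_iff inv_into_into, metis f_inv_into_f)
  have eA: "e i \<in> A" if "i < N" for i
    using that e unfolding bij_betw_def by auto
  define B where "B = mat N N (\<lambda>(i, j). K (e i) (e j))"
  have B: "B \<in> carrier_mat N N" by (simp add: B_def)
  have apply_B: "(B *\<^sub>v v) $ i = (\<Sum>y\<in>A. K (e i) y * v $ (e' y))"
    if "i < N" "v \<in> carrier_vec N" for i v
  proof -
    have "(B *\<^sub>v v) $ i = (\<Sum>j = 0..<N. K (e i) (e j) * v $ (e' (e j)))"
      using that by (simp add: B_def scalar_prod_def e'e)
    also have "\<dots> = (\<Sum>y\<in>A. K (e i) y * v $ (e' y))"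
      by (rule sum.reindex_bij_betw[OF e])
    finally show ?thesis .
  qed
  have "det B \<noteq> 0"
  proof
    assume "det B = 0"
    then obtain v where v: "v \<in> carrier_vec N" "v \<noteq> 0\<^sub>v N" "B *\<^sub>v v = 0\<^sub>v N"
      using det_0_iff_vec_prod_zero[OF B] by blast
    have "v $ (e' x) = 0" if "x \<in> A" for x
    proof (rule inj[OF _ that])
      fix x assume "x \<in> A"
      then show "(\<Sum>y\<in>A. K x y * v $ (e' y)) = 0"
        using apply_B[OF e'(1) v(1), of x] v(3) e' by simp
    qed
    then have "v $ i = 0" if "i < N" for i
      using eA[OF that] e'e[OF that] by metis
    then have "v = 0\<^sub>v N" using v(1) by (intro eq_vecI) auto
    with v(2) show False by blast
  qed
  \<comment> \<open>Being a unit of the matrix ring supplies an inverse; \<open>()\<close> only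
    fills the extension slot of the ring record.\<close>
  from det_non_zero_imp_unit[OF B this, of "()"] obtain C where
    C: "C \<in> carrier_mat N N" "B * C = 1\<^sub>m N"
    unfolding Units_def by (auto simp: ring_mat_def)
  define w where "w = C *\<^sub>v vec N (g \<circ> e)"
  have w: "w \<in> carrier_vec N" using C by (simp add: w_def)
  have Bw: "B *\<^sub>v w = vec N (g \<circ> e)"
    unfolding w_def using assoc_mult_mat_vec[OF B C(1), of "vec N (g \<circ> e)"] C(2) by simp
  have "(\<Sum>y\<in>A. K x y * w $ (e' y)) = g x" if "x \<in> A" for x
    using apply_B[OF e'(1)[OF that] w] e'[OF that] by (simp add: Bw)
  then show thesis by (rule that)
qed

section \<open>Summation by parts and the Poisson equation on a periodic grid\<close>

text \<open>The lattice is abstracted to two commuting permutations \<open>s\<close>,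
  \<open>t\<close> with inverses \<open>s'\<close>, \<open>t'\<close>, so that no coordinates enter
  the summations. The last assumption expresses connectedness: any two grid points are joined by
  shifts.\<close>

locale periodic_grid =
  fixes A :: "'a set" and s s' t t' :: "'a \<Rightarrow> 'a"
  assumes finite_grid: "finite A"
    and shift_in [simp]: "x \<in> A \<Longrightarrow> s x \<in> A" "x \<in> A \<Longrightarrow> s' x \<in> A"
      "x \<in> A \<Longrightarrow> t x \<in> A" "x \<in> A \<Longrightarrow> t' x \<in> A"
    and shift_inverse [simp]: "x \<in> A \<Longrightarrow> s (s' x) = x" "x \<in> A \<Longrightarrow> s' (s x) = x"
      "x \<in> A \<Longrightarrow> t (t' x) = x" "x \<in> A \<Longrightarrow> t' (t x) = x"
    and shift_commute: "x \<in> A \<Longrightarrow> s (t x) = t (s x)"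
    and invariant_imp_constant: "\<And>f :: 'a \<Rightarrow> real. (\<And>x. x \<in> A \<Longrightarrow> f (s x) = f x) \<Longrightarrow>
      (\<And>x. x \<in> A \<Longrightarrow> f (t x) = f x) \<Longrightarrow> x \<in> A \<Longrightarrow> y \<in> A \<Longrightarrow> f x = f y"
begin

text \<open>The five-point Laplacian without the factor 1/h^2, grouped as a backward difference of
  forward differences to fit summation by parts.\<close>

definition laplacian :: "('a \<Rightarrow> real) \<Rightarrow> 'a \<Rightarrow> real" where
  "laplacian f x = (f (s x) - f x - (f x - f (s' x))) + (f (t x) - f x - (f x - f (t' x)))"

lemma sum_shift_s: "(\<Sum>x\<in>A. f (s x)) = (\<Sum>x\<in>A. f x)" for f :: "'a \<Rightarrow> real"
  by (rule sum.reindex_bij_witness[of _ s' s]) auto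

lemma sum_shift_t: "(\<Sum>x\<in>A. f (t x)) = (\<Sum>x\<in>A. f x)" for f :: "'a \<Rightarrow> real"
  by (rule sum.reindex_bij_witness[of _ t' t]) auto

text \<open>The backward difference is minus the adjoint of the forward one. Since \<open>s\<close>
  permutes \<open>A\<close>, there are no boundary terms.\<close>

lemma sum_by_parts_s:
  "(\<Sum>x\<in>A. (f x - f (s' x)) * g x) = - (\<Sum>x\<in>A. f x * (g (s x) - g x))" for f g :: "'a \<Rightarrow> real"
proof -
  have "(\<Sum>x\<in>A. f (s' x) * g x) = (\<Sum>x\<in>A. f x * g (s x))"
    using sum_shift_s[of "\<lambda>x. f (s' x) * g x"] by simp
  then show ?thesis by (simp add: algebra_simps sum_subtractf)
qed

lemma sum_by_parts_t:
  "(\<Sum>x\<in>A. (f x - f (t' x)) * g x) = - (\<Sum>x\<in>A. f x * (g (t x) - g x))" for f g :: "'a \<Rightarrow> real"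
proof -
  have "(\<Sum>x\<in>A. f (t' x) * g x) = (\<Sum>x\<in>A. f x * g (t x))"
    using sum_shift_t[of "\<lambda>x. f (t' x) * g x"] by simp
  then show ?thesis by (simp add: algebra_simps sum_subtractf)
qed

text \<open>Discrete Green identity, from summation by parts in each direction. Testing with 1 gives
  zero mean, testing with \<open>f\<close> gives the Dirichlet energy.\<close>

lemma sum_laplacian_mult:
  "(\<Sum>x\<in>A. laplacian f x * g x) =
    - (\<Sum>x\<in>A. (f (s x) - f x) * (g (s x) - g x)) - (\<Sum>x\<in>A. (f (t x) - f x) * (g (t x) - g x))"
proof -
  define a b where "a x = f (s x) - f x" and "b x = f (t x) - f x" for x
  have "(\<Sum>x\<in>A. laplacian f x * g x) =
    (\<Sum>x\<in>A. (a x - a (s' x)) * g x) + (\<Sum>x\<in>A. (b x - b (t' x)) * g x)"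
    unfolding sum.distrib[symmetric]
    by (intro sum.cong refl) (simp add: laplacian_def a_def b_def algebra_simps)
  then show ?thesis
    unfolding sum_by_parts_s sum_by_parts_t by (simp add: a_def b_def)
qed

lemma sum_laplacian: "(\<Sum>x\<in>A. laplacian f x) = 0"
  using sum_laplacian_mult[of f "\<lambda>_. 1"] by simp

text \<open>Energy argument: the Dirichlet energy of \<open>f\<close> vanishes, so \<open>f\<close>
  is invariant under both shifts, and connectedness finishes.\<close>

lemma harmonic_imp_constant:
  assumes "\<And>x. x \<in> A \<Longrightarrow> laplacian f x = 0" "x \<in> A" "y \<in> A"
  shows "f x = f y"
proof -
  have "(\<Sum>x\<in>A. (f (s x) - f x)\<^sup>2 + (f (t x) - f x)\<^sup>2) = 0"
    using sum_laplacian_mult[of f f] assms(1) by (simp add: power2_eq_square sum.distrib)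
  then have "\<forall>x\<in>A. (f (s x) - f x)\<^sup>2 + (f (t x) - f x)\<^sup>2 = 0"
    by (subst (asm) sum_nonneg_eq_0_iff) (auto simp: finite_grid)
  then have "f (s x) = f x \<and> f (t x) = f x" if "x \<in> A" for x
    using that by (simp add: sum_power2_eq_zero_iff)
  then show ?thesis using invariant_imp_constant[of f x y] assms by blast
qed

text \<open>The Laplacian is singular, but subtracting the rank-one operator \<open>f \<mapsto> \<Sum>f\<close> makes it
  injective without changing it on functions of zero sum.\<close>

lemma poisson_solvable:
  fixes g :: "'a \<Rightarrow> real"
  assumes "(\<Sum>x\<in>A. g x) = 0"
  obtains f where "\<And>x. x \<in> A \<Longrightarrow> laplacian f x = g x"
proof -
  \<comment> \<open>Every neighbour has its own summand, so neighbours that coincide (as on the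
    lattice with n = 2) are counted with multiplicity, as in \<open>laplacian\<close>. The final
    \<open>- 1\<close> is the rank-one term.\<close>
  define K :: "'a \<Rightarrow> 'a \<Rightarrow> real" where
    "K x y = of_bool (y = s x) + of_bool (y = s' x) + of_bool (y = t x) + of_bool (y = t' x)
       - 4 * of_bool (y = x) - 1" for x y
  have delta: "(\<Sum>y\<in>A. of_bool (y = z) * f y) = f z" if "z \<in> A" for z and f :: "'a \<Rightarrow> real"
    using that by (simp add: of_bool_def if_distrib[of "\<lambda>c. c * _"] finite_grid cong: if_cong)
  have K: "(\<Sum>y\<in>A. K x y * f y) = laplacian f x - (\<Sum>y\<in>A. f y)" if "x \<in> A" for f x
  proof -
    have "(\<Sum>y\<in>A. K x y * f y) =
      (\<Sum>y\<in>A. of_bool (y = s x) * f y) + (\<Sum>y\<in>A. of_bool (y = s' x) * f y) +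
      (\<Sum>y\<in>A. of_bool (y = t x) * f y) + (\<Sum>y\<in>A. of_bool (y = t' x) * f y) -
      4 * (\<Sum>y\<in>A. of_bool (y = x) * f y) - (\<Sum>y\<in>A. f y)"
      by (simp only: K_def sum_distrib_left ring_distribs sum.distrib sum_subtractf mult.assoc mult_1)
    then show ?thesis using that by (simp only: delta shift_in) (simp add: laplacian_def)
  qed
  \<comment> \<open>Summing over \<open>A\<close> kills the Laplacian and leaves only the rank-one
    term. This serves twice: for injectivity, and for the solution with a right-hand side of zero
    sum.\<close>
  have zero_sum: "(\<Sum>y\<in>A. f y) = 0"
    if "(\<Sum>x\<in>A. \<Sum>y\<in>A. K x y * f y) = 0" for f
  proof -
    have "(\<Sum>x\<in>A. \<Sum>y\<in>A. K x y * f y) = - (card A * (\<Sum>y\<in>A. f y))"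
      by (simp add: K sum_subtractf sum_laplacian)
    then show ?thesis using that finite_grid by auto
  qed
  obtain f where f: "\<And>x. x \<in> A \<Longrightarrow> (\<Sum>y\<in>A. K x y * f y) = g x"
  proof (rule kernel_injective_imp_surjective[OF finite_grid, of K g])
    fix f x
    assume f0: "\<And>x. x \<in> A \<Longrightarrow> (\<Sum>y\<in>A. K x y * f y) = 0" and x: "x \<in> A"
    have sum0: "(\<Sum>y\<in>A. f y) = 0" by (rule zero_sum) (simp add: f0)
    \<comment> \<open>With zero sum, a null vector of \<open>K\<close> is harmonic, hence constant,
      hence zero.\<close>
    have "f y = f x" if "y \<in> A" for y
      using harmonic_imp_constant[of f y x] f0 sum0 that x by (simp add: K)
    then have "card A * f x = 0" using sum0 by simp
    then show "f x = 0" using x finite_grid by auto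
  qed (use that in blast)
  have "(\<Sum>y\<in>A. f y) = 0" by (rule zero_sum) (simp add: f assms)
  then have "laplacian f x = g x" if "x \<in> A" for x using f[OF that] K[OF that, of f] by simp
  then show thesis by (rule that)
qed

lemma shift_commute':
  assumes "x \<in> A"
  shows "s (t' x) = t' (s x)"
  using assms shift_commute[of "t' x"] by (metis shift_in shift_inverse(3,4))

text \<open>One summation by parts in each direction moves a difference from either factor to the
  other, so the product of the two pure second differences becomes the square of the mixed
  one.\<close>

lemma sum_mixed_differences:
  "(\<Sum>x\<in>A. (f (s x) - f x - (f x - f (s' x))) * (f (t x) - f x - (f x - f (t' x)))) =
    (\<Sum>x\<in>A. (f (t (s x)) - f (s x) - f (t x) + f x)\<^sup>2)"
  for f :: "'a \<Rightarrow> real"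
proof -
  define a b c :: "'a \<Rightarrow> real" where "a x = f (s x) - f x" and "b x = f (t x) - f x"
    and "c x = f (t (s x)) - f (s x) - f (t x) + f x" for x
  have "(\<Sum>x\<in>A. (f (s x) - f x - (f x - f (s' x))) * (f (t x) - f x - (f x - f (t' x)))) =
    (\<Sum>x\<in>A. (a x - a (s' x)) * (b x - b (t' x)))"
    by (intro sum.cong refl) (simp add: a_def b_def)
  also have "\<dots> = - (\<Sum>x\<in>A. a x * (b (s x) - b (t' (s x)) - (b x - b (t' x))))"
    by (rule sum_by_parts_s)
  \<comment> \<open>\<open>c\<close> is both the s-difference of \<open>b\<close>, used here, and
    the t-difference of \<open>a\<close>, used at the end.\<close>
  also have "\<dots> = - (\<Sum>x\<in>A. (c x - c (t' x)) * a x)"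
    by (intro arg_cong[of _ _ uminus] sum.cong refl)
      (simp add: a_def b_def c_def shift_commute' algebra_simps)
  also have "\<dots> = (\<Sum>x\<in>A. c x * (a (t x) - a x))"
    unfolding sum_by_parts_t by simp
  also have "\<dots> = (\<Sum>x\<in>A. (c x)\<^sup>2)"
    by (intro sum.cong refl) (simp add: a_def c_def shift_commute power2_eq_square)
  finally show ?thesis unfolding c_def .
qed

text \<open>Expanding the square yields the cross term twice, one copy for each mixed difference of
  the gradient. The pure second differences only need recentring by a shift.\<close>

lemma sum_laplacian_power2:
  "(\<Sum>x\<in>A. (laplacian f x)\<^sup>2) =
    (\<Sum>x\<in>A. ((f (s (s x)) - f (s x)) - (f (s x) - f x))\<^sup>2) +
    (\<Sum>x\<in>A. ((f (s (t x)) - f (t x)) - (f (s x) - f x))\<^sup>2) +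
    (\<Sum>x\<in>A. ((f (t (s x)) - f (s x)) - (f (t x) - f x))\<^sup>2) +
    (\<Sum>x\<in>A. ((f (t (t x)) - f (t x)) - (f (t x) - f x))\<^sup>2)"
proof -
  let ?ss = "\<lambda>x. f (s x) - f x - (f x - f (s' x))" and ?tt = "\<lambda>x. f (t x) - f x - (f x - f (t' x))"
  have ss: "(\<Sum>x\<in>A. (?ss x)\<^sup>2) = (\<Sum>x\<in>A. ((f (s (s x)) - f (s x)) - (f (s x) - f x))\<^sup>2)"
    using sum_shift_s[of "\<lambda>x. (?ss x)\<^sup>2"] by simp
  have tt: "(\<Sum>x\<in>A. (?tt x)\<^sup>2) = (\<Sum>x\<in>A. ((f (t (t x)) - f (t x)) - (f (t x) - f x))\<^sup>2)"
    using sum_shift_t[of "\<lambda>x. (?tt x)\<^sup>2"] by simp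
  have st: "(\<Sum>x\<in>A. ?ss x * ?tt x) = (\<Sum>x\<in>A. ((f (s (t x)) - f (t x)) - (f (s x) - f x))\<^sup>2)"
    unfolding sum_mixed_differences by (intro sum.cong refl) (simp add: shift_commute algebra_simps)
  have ts: "(\<Sum>x\<in>A. ?ss x * ?tt x) = (\<Sum>x\<in>A. ((f (t (s x)) - f (s x)) - (f (t x) - f x))\<^sup>2)"
    unfolding sum_mixed_differences by (intro sum.cong refl) (simp add: algebra_simps)
  have "(\<Sum>x\<in>A. (laplacian f x)\<^sup>2) =
    (\<Sum>x\<in>A. (?ss x)\<^sup>2) + (\<Sum>x\<in>A. ?ss x * ?tt x) + (\<Sum>x\<in>A. ?ss x * ?tt x) + (\<Sum>x\<in>A. (?tt x)\<^sup>2)"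
    unfolding sum.distrib[symmetric]
    by (intro sum.cong refl) (simp add: laplacian_def power2_eq_square algebra_simps)
  then show ?thesis unfolding ss tt using st ts by simp
qed

end

section \<open>The pressure lattice as a periodic grid\<close>

abbreviation shift :: "nat \<Rightarrow> point \<Rightarrow> point \<Rightarrow> point" where
  "shift n e y \<equiv> tor (y + (1 / real n) *\<^sub>R e)"

abbreviation shift_back :: "nat \<Rightarrow> point \<Rightarrow> point \<Rightarrow> point" where
  "shift_back n e y \<equiv> tor (y - (1 / real n) *\<^sub>R e)"

text \<open>\<open>T n\<close> is indexed by all pairs of integers, but the fractional part of k/n
  depends only on k modulo n.\<close>

lemma finite_T:
  assumes "n > 0"
  shows "finite (T n)"
proof -
  have frac_lattice: "frac (of_int k * (1 / real n)) = of_int (k mod int n) / real n" for k :: int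
  proof -
    have "real_of_int k = of_int (k div int n) * real n + of_int (k mod int n)"
      by (metis div_mult_mod_eq of_int_add of_int_mult of_int_of_nat_eq)
    then have "of_int k * (1 / real n) = of_int (k mod int n) / real n + of_int (k div int n)"
      using assms by (simp add: field_simps)
    then have "frac (of_int k * (1 / real n)) = frac (of_int (k mod int n) / real n)"
      by (simp only: frac_add_of_int_right)
    moreover have "real_of_int (k mod int n) < real n"
      using assms by (metis of_int_less_iff of_int_of_nat_eq of_nat_0_less_iff pos_mod_bound)
    ultimately show ?thesis using assms by (simp add: frac_eq)
  qed
  have "T n \<subseteq> (\<lambda>(k, j). (of_int k / real n, of_int j / real n)) ` ({0..<int n} \<times> {0..<int n})"
  proof
    fix y assume "y \<in> T n"
    then obtain k j where "y = (of_int (k mod int n) / real n, of_int (j mod int n) / real n)"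
      by (auto simp: T_def tor_def frac_lattice simp del: mult_1_right times_divide_eq_right)
    then show "y \<in> (\<lambda>(k, j). (of_int k / real n, of_int j / real n)) ` ({0..<int n} \<times> {0..<int n})"
      using assms by (intro image_eqI[of _ _ "(k mod int n, j mod int n)"]) auto
  qed
  then show ?thesis by (rule finite_subset) simp
qed

lemma shift_invariant_imp_constant:
  fixes f :: "point \<Rightarrow> real"
  assumes f1: "\<And>x. x \<in> T n \<Longrightarrow> f (shift n e1 x) = f x"
    and f2: "\<And>x. x \<in> T n \<Longrightarrow> f (shift n e2 x) = f x"
    and "x \<in> T n" "y \<in> T n"
  shows "f x = f y"
proof -
  \<comment> \<open>Indices are left unreduced, so induction over the integers, upwards and
    downwards, walks to \<open>p 0 0\<close> without treating the wrap-around.\<close>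
  define p :: "int \<Rightarrow> int \<Rightarrow> point" where
    "p k j = tor (of_int k * (1 / real n), of_int j * (1 / real n))" for k j
  have pT: "p k j \<in> T n" for k j unfolding p_def T_def by blast
  have p1: "shift n e1 (p k j) = p (k + 1) j" for k j
    by (simp add: p_def tor_tor_add e1_def add_divide_distrib)
  have p2: "shift n e2 (p k j) = p k (j + 1)" for k j
    by (simp add: p_def tor_tor_add e2_def add_divide_distrib)
  have s1: "f (p (k + 1) j) = f (p k j)" and s2: "f (p k (j + 1)) = f (p k j)" for k j
    using f1[OF pT] f2[OF pT] by (simp_all only: p1 p2)
  have "f (p k j) = f (p 0 j)" for k j
  proof (induction k rule: int_induct[of _ 0])
    case (step2 i) then show ?case using s1[of "i - 1" j] by simp
  qed (simp_all add: s1)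
  moreover have "f (p 0 j) = f (p 0 0)" for j
  proof (induction j rule: int_induct[of _ 0])
    case (step2 i) then show ?case using s2[of 0 "i - 1"] by simp
  qed (simp_all add: s2)
  moreover have "\<exists>k j. z = p k j" if "z \<in> T n" for z
    using that unfolding T_def p_def by blast
  ultimately show ?thesis using assms(3,4) by metis
qed

lemma periodic_grid_T:
  assumes "n > 0"
  shows "periodic_grid (T n) (shift n e1) (shift_back n e1) (shift n e2) (shift_back n e2)"
proof
  show "finite (T n)" by (rule finite_T[OF assms])
next
  fix x assume x: "x \<in> T n"
  show "shift n e1 x \<in> T n" "shift_back n e1 x \<in> T n" "shift n e2 x \<in> T n" "shift_back n e2 x \<in> T n"
    using tor_shift_T[OF x] by simp_all
  show "shift n e1 (shift_back n e1 x) = x" "shift_back n e1 (shift n e1 x) = x"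
    "shift n e2 (shift_back n e2 x) = x" "shift_back n e2 (shift n e2 x) = x"
    by (simp_all add: tor_tor_add tor_tor_diff tor_T[OF x])
  show "shift n e1 (shift n e2 x) = shift n e2 (shift n e1 x)"
    by (simp only: tor_tor_add) (simp only: add_ac)
next
  fix f :: "point \<Rightarrow> real" and x y
  assume "\<And>x. x \<in> T n \<Longrightarrow> f (shift n e1 x) = f x" "\<And>x. x \<in> T n \<Longrightarrow> f (shift n e2 x) = f x"
    "x \<in> T n" "y \<in> T n"
  then show "f x = f y" by (rule shift_invariant_imp_constant)
qed

section \<open>Discrete gradients on the staggered points\<close>

lemma inj_on_half_shift: "inj_on (\<lambda>y. tor (y + c)) (T n)"
proof (rule inj_on_inverseI)
  fix y assume "y \<in> T n"
  then show "tor (tor (y + c) - c) = y" by (simp add: tor_tor_diff tor_T)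
qed

text \<open>Half shifts commute with full shifts, so both velocity components can be pulled back to
  functions \<open>a\<close>, \<open>b\<close> on \<open>T n\<close>. The factor n^2 comes from the
  division by h = 1/n.\<close>

lemma D_norm_power2:
  assumes "n > 0"
    and u: "\<And>y. y \<in> T n \<Longrightarrow> u (tor (y + (1 / real n / 2) *\<^sub>R e1)) = a y"
    and v: "\<And>y. y \<in> T n \<Longrightarrow> v (tor (y + (1 / real n / 2) *\<^sub>R e2)) = b y"
  shows "(D_norm n (u, v))\<^sup>2 = (real n)\<^sup>2 *
    ((\<Sum>y\<in>T n. (a (shift n e1 y) - a y)\<^sup>2) + (\<Sum>y\<in>T n. (a (shift n e2 y) - a y)\<^sup>2) +
     (\<Sum>y\<in>T n. (b (shift n e1 y) - b y)\<^sup>2) + (\<Sum>y\<in>T n. (b (shift n e2 y) - b y)\<^sup>2))"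
proof -
  have fin: "finite (S1 n)" "finite (S2 n)"
    using finite_T[OF assms(1)] by (simp_all add: S1_def S2_def)
  have e12: "e1 \<noteq> e2" by (simp add: e1_def e2_def)
  have quot: "(\<Sum>z\<in>(\<lambda>y. tor (y + (1 / real n / 2) *\<^sub>R d)) ` T n. (dquot n w (e, z))\<^sup>2) =
    (real n)\<^sup>2 * (\<Sum>y\<in>T n. (c (shift n e y) - c y)\<^sup>2)"
    if w: "\<And>y. y \<in> T n \<Longrightarrow> w (tor (y + (1 / real n / 2) *\<^sub>R d)) = c y" and e: "e \<in> {e1, e2}"
    for w c d e
  proof -
    have "dquot n w (e, tor (y + (1 / real n / 2) *\<^sub>R d)) = real n * (c (shift n e y) - c y)"
      if "y \<in> T n" for y
    proof -
      have "tor (tor (y + (1 / real n / 2) *\<^sub>R d) + (1 / real n) *\<^sub>R e) =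
        tor (shift n e y + (1 / real n / 2) *\<^sub>R d)"
        by (simp only: tor_tor_add) (simp only: add_ac)
      then have "w (tor (tor (y + (1 / real n / 2) *\<^sub>R d) + (1 / real n) *\<^sub>R e)) = c (shift n e y)"
        using w[OF tor_shift_T(1)[OF that e]] by simp
      then show ?thesis using w[OF that] by (simp add: dquot_def Let_def)
    qed
    then show ?thesis
      by (simp add: sum.reindex[OF inj_on_half_shift] power_mult_distrib sum_distrib_left)
  qed
  have "(D_norm n (u, v))\<^sup>2 = (\<Sum>i\<in>D_index n. (D n (u, v) i)\<^sup>2)"
    unfolding D_norm_def L2_set_def by (simp add: sum_nonneg)
  also have "\<dots> = (\<Sum>(e, z)\<in>{e1, e2} \<times> S1 n. (dquot n u (e, z))\<^sup>2) +
    (\<Sum>(e, z)\<in>{e1, e2} \<times> S2 n. (dquot n v (e, z))\<^sup>2)"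
    unfolding D_index_def by (subst sum.Plus) (auto simp: fin D_def case_prod_unfold)
  also have "\<dots> = (\<Sum>e\<in>{e1, e2}. \<Sum>z\<in>S1 n. (dquot n u (e, z))\<^sup>2) +
    (\<Sum>e\<in>{e1, e2}. \<Sum>z\<in>S2 n. (dquot n v (e, z))\<^sup>2)"
    by (simp only: sum.cartesian_product)
  also have "\<dots> = (real n)\<^sup>2 *
    ((\<Sum>y\<in>T n. (a (shift n e1 y) - a y)\<^sup>2) + (\<Sum>y\<in>T n. (a (shift n e2 y) - a y)\<^sup>2) +
     (\<Sum>y\<in>T n. (b (shift n e1 y) - b y)\<^sup>2) + (\<Sum>y\<in>T n. (b (shift n e2 y) - b y)\<^sup>2))"
    using e12 quot[where w = u and c = a and d = e1, OF u] quot[where w = v and c = b and d = e2, OF v]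
    by (simp add: S1_def S2_def distrib_left)
  finally show ?thesis .
qed

lemma velocity_with_divergence:
  assumes "n > 0" and P: "(\<Sum>y\<in>T n. P y) = 0"
  obtains U where "\<And>y. y \<in> T n \<Longrightarrow> div_star n U y = P y" "D_norm n U = L2_set P (T n)"
proof -
  interpret periodic_grid "T n" "shift n e1" "shift_back n e1" "shift n e2" "shift_back n e2"
    by (rule periodic_grid_T[OF assms(1)])
  \<comment> \<open>The scaling compensates for the missing 1/h^2 in \<open>laplacian\<close> and
    preserves the zero sum.\<close>
  have "(\<Sum>y\<in>T n. P y / (real n)\<^sup>2) = 0" using P by (simp flip: sum_divide_distrib)
  then obtain f where f: "\<And>y. y \<in> T n \<Longrightarrow> laplacian f y = P y / (real n)\<^sup>2"
    using poisson_solvable by blast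
  \<comment> \<open>The difference quotient of \<open>f\<close> across the edge with midpoint
    \<open>z\<close>. For \<open>z\<close> in the matching staggered lattice both endpoints lie in
    \<open>T n\<close>.\<close>
  define w where "w e z =
    real n * (f (tor (z + (1 / real n / 2) *\<^sub>R e)) - f (tor (z - (1 / real n / 2) *\<^sub>R e)))" for e z
  have half_half: "y + (1 / real n / 2) *\<^sub>R e + (1 / real n / 2) *\<^sub>R e = y + (1 / real n) *\<^sub>R e"
    "y - (1 / real n / 2) *\<^sub>R e - (1 / real n / 2) *\<^sub>R e = y - (1 / real n) *\<^sub>R e" for y e :: point
    by (simp_all add: prod_eq_iff field_simps)
  have w_plus: "w e (tor (y + (1 / real n / 2) *\<^sub>R e)) = real n * (f (shift n e y) - f y)"
    if "y \<in> T n" for y e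
    using that by (simp add: w_def tor_tor_add tor_tor_diff tor_T half_half del: divide_divide_eq_left)
  have w_minus: "w e (tor (y - (1 / real n / 2) *\<^sub>R e)) = real n * (f y - f (shift_back n e y))"
    if "y \<in> T n" for y e
    using that by (simp add: w_def tor_tor_add tor_tor_diff tor_T half_half del: divide_divide_eq_left)
  show thesis
  proof (rule that[of "(w e1, w e2)"])
    fix y assume y: "y \<in> T n"
    have "div_star n (w e1, w e2) y = (real n)\<^sup>2 * laplacian f y"
      unfolding div_star_def Let_def prod.case w_plus[OF y] w_minus[OF y] laplacian_def
      by (simp add: power2_eq_square algebra_simps)
    then show "div_star n (w e1, w e2) y = P y" using f[OF y] assms(1) by simp
  next
    \<comment> \<open>One n^2 stems from \<open>DU\<close>, the other from the factor n in
      \<open>w\<close>; together they cancel the square of 1/n^2 in the equation for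
      \<open>f\<close>.\<close>
    have "(D_norm n (w e1, w e2))\<^sup>2 = (real n)\<^sup>2 * ((real n)\<^sup>2 * (\<Sum>y\<in>T n. (laplacian f y)\<^sup>2))"
      by (subst D_norm_power2[where a = "\<lambda>y. real n * (f (shift n e1 y) - f y)"
            and b = "\<lambda>y. real n * (f (shift n e2 y) - f y)", OF assms(1)])
        (simp_all only: w_plus sum_laplacian_power2 right_diff_distrib[symmetric]
          power_mult_distrib sum_distrib_left[symmetric] distrib_left)
    also have "\<dots> = (\<Sum>y\<in>T n. (P y)\<^sup>2)"
      using assms(1) by (simp add: f sum_distrib_left power_divide power2_eq_square)
    also have "\<dots> = (L2_set P (T n))\<^sup>2" by (simp add: L2_set_def sum_nonneg)
    finally show "D_norm n (w e1, w e2) = L2_set P (T n)"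
      by (simp add: D_norm_def power2_eq_iff_nonneg)
  qed
qed

section \<open>The inf-sup bound\<close>

text \<open>With D*U = P and DU of the same norm as P, numerator and denominator are both the
  squared norm of P. As P is nonzero, this is not 0/0, and DU cannot vanish.\<close>

lemma inf_sup_quotient_attained:
  assumes "n > 0" and P: "(\<Sum>y\<in>T n. P y) = 0" "\<exists>y\<in>T n. P y \<noteq> 0"
  obtains U where "\<exists>i\<in>D_index n. D n U i \<noteq> 0"
    "pressure_inner n (div_star n U) P / (L2_set P (T n) * D_norm n U) = 1"
proof -
  obtain U where U: "\<And>y. y \<in> T n \<Longrightarrow> div_star n U y = P y" "D_norm n U = L2_set P (T n)"
    using velocity_with_divergence[OF assms(1) P(1)] by blast
  have pos: "L2_set P (T n) \<noteq> 0"
    using P(2) by (simp add: L2_set_eq_0_iff finite_T[OF assms(1)])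
  have "pressure_inner n (div_star n U) P = L2_set P (T n) * L2_set P (T n)"
    by (simp add: pressure_inner_def U(1) L2_set_def sum_nonneg flip: power2_eq_square)
  moreover have "\<exists>i\<in>D_index n. D n U i \<noteq> 0"
  proof (rule ccontr)
    assume "\<not> ?thesis"
    then have "D_norm n U = 0" by (simp add: D_norm_def L2_set_def)
    with U(2) pos show False by simp
  qed
  ultimately show thesis using that[of U] U(2) pos by simp
qed

theorem theorem3p1:
  fixes m :: nat and \<Phi> :: "real \<times> real \<Rightarrow> real"
  assumes "window_function \<Phi>"
  shows "\<exists>\<mu>::real. \<mu> > 0 \<and>
    (\<forall>(n::nat) (\<rho>::real) (R :: (real \<times> real) set).
       n > 0 \<longrightarrow> \<rho> > 0 \<longrightarrow> regular_nodes m \<Phi> \<rho> R \<longrightarrow>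
       realizes m \<Phi> \<rho> R (S n) \<longrightarrow> realizes m \<Phi> \<rho> R (T n) \<longrightarrow>
         (INF P \<in> {P. (\<Sum>y\<in>T n. P y) = 0 \<and> (\<exists>y\<in>T n. P y \<noteq> 0)}.
            SUP U \<in> {U. \<exists>a\<in>D_index n. D n U a \<noteq> 0}.
              ereal (pressure_inner n (div_star n U) P / (L2_set P (T n) * D_norm n U)))
           \<ge> ereal \<mu> \<and>
         (\<forall>P :: real \<times> real \<Rightarrow> real. \<exists>p.
            \<forall>y\<in>T n. P y = (\<Sum>x\<in>R. shape m \<Phi> \<rho> R x y * p x)) \<and>
         (\<forall>u v :: real \<times> real \<Rightarrow> real. \<exists>uc vc.
            (\<forall>z\<in>S1 n. u z = (\<Sum>x\<in>R. shape m \<Phi> \<rho> R x z * uc x)) \<and>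
            (\<forall>z\<in>S2 n. v z = (\<Sum>x\<in>R. shape m \<Phi> \<rho> R x z * vc x))))"
proof (intro exI[of _ 1] conjI allI impI)
  fix n :: nat and \<rho> :: real and R :: "(real \<times> real) set"
  assume n: "n > 0" and S: "realizes m \<Phi> \<rho> R (S n)" and T: "realizes m \<Phi> \<rho> R (T n)"
  show "(INF P \<in> {P. (\<Sum>y\<in>T n. P y) = 0 \<and> (\<exists>y\<in>T n. P y \<noteq> 0)}.
      SUP U \<in> {U. \<exists>a\<in>D_index n. D n U a \<noteq> 0}.
        ereal (pressure_inner n (div_star n U) P / (L2_set P (T n) * D_norm n U))) \<ge> ereal 1"
  \<comment> \<open>This also covers n = 1, where no nonzero pressure has zero sum and the infimum
    over the empty set is the top element.\<close>
  proof (rule INF_greatest)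
    fix P :: "point \<Rightarrow> real"
    assume "P \<in> {P. (\<Sum>y\<in>T n. P y) = 0 \<and> (\<exists>y\<in>T n. P y \<noteq> 0)}"
    then obtain U where "\<exists>a\<in>D_index n. D n U a \<noteq> 0"
      "pressure_inner n (div_star n U) P / (L2_set P (T n) * D_norm n U) = 1"
      using inf_sup_quotient_attained[OF n] by blast
    then show "ereal 1 \<le> (SUP U \<in> {U. \<exists>a\<in>D_index n. D n U a \<noteq> 0}.
        ereal (pressure_inner n (div_star n U) P / (L2_set P (T n) * D_norm n U)))"
      by (intro SUP_upper2[of U]) auto
  qed
  show "\<exists>p. \<forall>y\<in>T n. P y = (\<Sum>x\<in>R. shape m \<Phi> \<rho> R x y * p x)" for P
    using T unfolding realizes_def by blast
  fix u v :: "real \<times> real \<Rightarrow> real"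
  \<comment> \<open>Each component is realized on all of \<open>S n\<close> and then restricted to
    its own lattice.\<close>
  obtain uc vc where "\<forall>z\<in>S n. u z = (\<Sum>x\<in>R. shape m \<Phi> \<rho> R x z * uc x)"
    "\<forall>z\<in>S n. v z = (\<Sum>x\<in>R. shape m \<Phi> \<rho> R x z * vc x)"
    using S unfolding realizes_def by metis
  then show "\<exists>uc vc. (\<forall>z\<in>S1 n. u z = (\<Sum>x\<in>R. shape m \<Phi> \<rho> R x z * uc x)) \<and>
      (\<forall>z\<in>S2 n. v z = (\<Sum>x\<in>R. shape m \<Phi> \<rho> R x z * vc x))"
    unfolding S_def by (intro exI[of _ uc] exI[of _ vc]) blast
qed simp

end
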